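(* Let $D_0,R,\mu_0>0$, and let $\mathbf g:\mathbb R\times\mathbb C^d\to\mathbb C^d$ be a periodic vector field with Fourier coefficients $\mathbf g_{\boldsymbol\alpha}(t)=[g_{1,\boldsymbol\alpha}(t),\ldots,g_{d,\boldsymbol\alpha}(t)]^T$, $\boldsymbol\alpha\in\mathbb Z^d$, such that (1) $\mathbf g_{\boldsymbol\alpha}(t)=\mathbf 0$ for all $\boldsymbol\alpha\in\mathbb Z^d\setminus\mathbb Z_+^d$ and $t\ge 0$; (2) $\sup_{t\ge 0}\sum_{|\boldsymbol\alpha|=k}\sum_{j=1}^d |g_{j,\boldsymbol\alpha}(t)|\le D_0R^{-k}$ for all integers $k\ge 0$; and (3) $\min_{1\le j\le d}\Im g_{j,\mathbf 0}(t)\ge\mu_0$ for all $t\ge0$. Let $\mathbf x(t)=[x_1(t),\ldots,x_d(t)]^T$ be the solution of $\dot{\mathbf x}=\mathbf g(t,\mathbf x)$, $t\ge0$, with initial state $\mathbf x(0)=\mathbf x_0=[x_{0,1},\ldots,x_{0,d}]^T\in\mathbb C^d$ satisfying $$\|\exp(i\mathbf x_0)\|_2<\frac{\mu_0R}{D_0+\mu_0}.$$ Let $T>0$ and suppose that the order $N\ge1$ of the finite-section approximation satisfies $$\frac{\mu_0R\,\|\exp(-i\mathbf x_0)\|_\infty}{D_0}\Big(\frac{(D_0+\mu_0)\|\exp(i\mathbf x_0)\|_2}{\mu_0R}\Big)^Ne^{(D_0+\mu_0)T}\le\frac12 .$$ Then the entries $v_{j,N}$, $1\le j\le d$, of the first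 block of the finite-section approximation of order $N$ of the Carleman-Fourier linearization (defined in the context) can be written on $[0,T]$ as $v_{j,N}(t)=e^{i\xi_{j,N}(t)}$ with $\xi_{j,N}$ continuous, $\xi_{j,N}(0)=x_{0,j}$, and $$\sup_{1\le j\le d}|\xi_{j,N}(t)-x_j(t)|\le\frac{4\mu_0R\,\|\exp(-i\mathbf x_0)\|_\infty}{D_0}\Big(\frac{(D_0+\mu_0)\|\exp(i\mathbf x_0)\|_2}{\mu_0R}\Big)^Ne^{(D_0+\mu_0)t},\qquad 0\le t\le T .$$
   Context: Notation: $\mathbb Z_+^d$ is the set of $d$-tuples of nonnegative integers; for $\boldsymbol\alpha\in\mathbb Z^d$, $|\boldsymbol\alpha|=|\alpha_1|+\cdots+|\alpha_d|$ and $\boldsymbol\alpha\mathbf x=\alpha_1x_1+\cdots+\alpha_dx_d$; $\mathbb Z_{+,k}^d=\{\boldsymbol\alpha\in\mathbb Z_+^d:|\boldsymbol\alpha|=k\}$. $\Im$ denotes imaginary part; $\exp(\pm i\mathbf x)$ is taken componentwise; $\|\cdot\|_p$ is the standard $p$-norm on $\mathbb C^d$. The periodic vector field $\mathbf g$ is given by its Fourier expansion $\mathbf g(t,\mathbf x)=\sum_{\boldsymbol\alpha\in\mathbb Z^d}\mathbf g_{\boldsymbol\alpha}(t)e^{i\boldsymbol\alpha\mathbf x}$ (which, under (1) and (2), converges when $\min_j\Im x_j>-\ln R$). Finite-section approximation of the Carleman-Fourier linearization: put $$\mathbf B_{k,l}(t)=\big[\,i\,\boldsymbol\alpha^T\mathbf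 g_{\boldsymbol\beta-\boldsymbol\alpha}(t)\,\big]_{\boldsymbol\alpha\in\mathbb Z_{+,k}^d,\ \boldsymbol\beta\in\mathbb Z_{+,l}^d},\qquad k,l\ge1 .$$ The finite-section approximation of order $N\ge1$ is the finite linear ODE system $$\dot{\mathbf v}_{k,N}(t)=\sum_{l=k}^N\mathbf B_{k,l}(t)\mathbf v_{l,N}(t),\qquad \mathbf v_{k,N}(0)=[e^{i\boldsymbol\alpha\mathbf x_0}]_{\boldsymbol\alpha\in\mathbb Z_{+,k}^d},\qquad 1\le k\le N .$$ Its first block $\mathbf v_{1,N}$ is indexed by the unit vectors $\mathbf e_1,\ldots,\mathbf e_d$; its entry with index $\mathbf e_j$ is the scalar denoted $v_{j,N}(t)$. *)

theory Defs
  imports "HOL-Analysis.Analysis"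
begin

definition mi_abs :: "int ^ 'd::finite \<Rightarrow> nat" where
  "mi_abs \<alpha> = (\<Sum>j\<in>UNIV. nat \<bar>\<alpha> $ j\<bar>)"

definition mi_dot :: "int ^ 'd::finite \<Rightarrow> complex ^ 'd \<Rightarrow> complex" where
  "mi_dot \<alpha> x = (\<Sum>j\<in>UNIV. of_int (\<alpha> $ j) * x $ j)"

definition mi_nonneg :: "(int ^ 'd::finite) set" where
  "mi_nonneg = {\<alpha>. \<forall>j. 0 \<le> \<alpha> $ j}"

definition mi_level :: "nat \<Rightarrow> (int ^ 'd::finite) set" where
  "mi_level k = {\<alpha> \<in> mi_nonneg. mi_abs \<alpha> = k}"

definition cexp :: "complex ^ 'd::finite \<Rightarrow> complex ^ 'd" where
  "cexp z = (\<chi> j. exp (z $ j))"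

text \<open>The library's \<open>infnorm\<close> takes real and imaginary parts as separate coordinates, so it
  is not the maximum of the moduli.  The Euclidean norm on \<open>complex ^ 'd\<close> is \<open>norm\<close>.\<close>

definition sup_norm :: "complex ^ 'd::finite \<Rightarrow> real" where
  "sup_norm z = (MAX j. cmod (z $ j))"

text \<open>\<open>G\<close> is \<open>2\<pi>\<close>-periodic in each coordinate of the state variable and is the sum of its
  Fourier expansion on the region \<open>min\<^sub>j Im x\<^sub>j > - ln R\<close>, where the decay of the
  coefficients makes that expansion converge.  Outside this region its values are
  constrained by periodicity only.\<close>

definition periodic_field_with_coeffs ::
    "real \<Rightarrow> (int ^ 'd::finite \<Rightarrow> real \<Rightarrow> complex ^ 'd) \<Rightarrow> (real \<Rightarrow> complex ^ 'd \<Rightarrow> complex ^ 'd) \<Rightarrow> bool" where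
  "periodic_field_with_coeffs R g G \<longleftrightarrow>
     (\<forall>t x j. G t (x + axis j (of_real (2 * pi))) = G t x) \<and>
     (\<forall>t\<ge>0. \<forall>x. (MIN j. Im (x $ j)) > - ln R \<longrightarrow>
        ((\<lambda>\<alpha>. exp (\<i> * mi_dot \<alpha> x) *s g \<alpha> t) has_sum G t x) UNIV)"

definition solves_ode_from ::
    "(real \<Rightarrow> complex ^ 'd::finite \<Rightarrow> complex ^ 'd) \<Rightarrow> complex ^ 'd \<Rightarrow> (real \<Rightarrow> complex ^ 'd) \<Rightarrow> bool" where
  "solves_ode_from G x0 x \<longleftrightarrow>
     x 0 = x0 \<and> (\<forall>t\<ge>0. (x has_vector_derivative G t (x t)) (at t within {0..}))"

text \<open>The entry with row index \<open>\<alpha>\<close> and column index \<open>\<beta>\<close>; the block \<open>B\<^sub>k\<^sub>l\<close> is its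
  restriction to \<open>mi_level k \<times> mi_level l\<close>.\<close>

definition cf_entry ::
    "(int ^ 'd::finite \<Rightarrow> real \<Rightarrow> complex ^ 'd) \<Rightarrow> real \<Rightarrow> int ^ 'd \<Rightarrow> int ^ 'd \<Rightarrow> complex" where
  "cf_entry g t \<alpha> \<beta> = \<i> * mi_dot \<alpha> (g (\<beta> - \<alpha>) t)"

text \<open>\<open>v k \<alpha>\<close> is the entry with index \<open>\<alpha> \<in> mi_level k\<close> of the \<open>k\<close>-th block.\<close>

definition finite_section_approx ::
    "(int ^ 'd::finite \<Rightarrow> real \<Rightarrow> complex ^ 'd) \<Rightarrow> complex ^ 'd \<Rightarrow> nat \<Rightarrow>
     (nat \<Rightarrow> int ^ 'd \<Rightarrow> real \<Rightarrow> complex) \<Rightarrow> bool" where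
  "finite_section_approx g x0 N v \<longleftrightarrow>
     (\<forall>k\<in>{1..N}. \<forall>\<alpha>\<in>mi_level k.
        v k \<alpha> 0 = exp (\<i> * mi_dot \<alpha> x0) \<and>
        (\<forall>t\<ge>0. (v k \<alpha> has_vector_derivative
             (\<Sum>l=k..N. \<Sum>\<beta>\<in>mi_level l. cf_entry g t \<alpha> \<beta> * v l \<beta> t)) (at t within {0..})))"

end

theory Submission
  imports Defs
begin

text \<open>
  Write \<open>y\<^sub>j = exp (i x\<^sub>j)\<close> and \<open>w\<^sub>\<alpha> = exp (i \<alpha> x)\<close>.  The monomials \<open>w\<^sub>\<alpha>\<close>, for nonnegative
  \<open>\<alpha>\<close>, solve an infinite linear system, and the finite section discards its rows and columns with index
  of level above \<open>N\<close>.  Since only Fourier modes in the nonnegative orthant occur, the system is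
  block upper triangular, and on level \<open>k\<close> its diagonal damps at rate at least \<open>k \<mu>\<close>, because the
  diagonal entry is \<open>i \<alpha> g\<^sub>0\<close>.

  First, \<open>|y(t)|\<close> never exceeds its initial value: while \<open>|y| < \<mu>R/(D + \<mu>)\<close>,
  the modes other than \<open>g\<^sub>0\<close> contribute at most \<open>\<mu>\<close> to each component of the field, so every
  \<open>Im x\<^sub>j\<close> is nondecreasing and \<open>|y|\<close> cannot grow (\<open>solution_trapped\<close>).  In particular the
  Fourier expansion stays valid and \<open>|w\<^sub>\<alpha>| \<le> s ^ |\<alpha>|\<close> for all times, where \<open>s = |y(0)|\<close>.

  Second, the errors \<open>u\<^sub>\<alpha> = v\<^sub>\<alpha> - w\<^sub>\<alpha>\<close> start at zero and satisfy the triangular system driven by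
  the discarded columns \<open>|\<beta>| > N\<close>.  A scalar equation with damping \<open>m\<close> and forcing at most \<open>m A\<close> cannot
  leave the disc of radius \<open>A\<close> (\<open>linear_ode_trapped\<close>).  Working downwards from level \<open>N\<close>, this
  gives bounds constant in time: the bound for level \<open>k\<close> is the forcing caused by the higher
  levels and the tail, divided by \<open>k \<mu>\<close>.  The factor \<open>k\<close> cancels, because a row of the block
  \<open>(k, l)\<close> has absolute sum at most \<open>k D R\<^sup>k\<^sup>-\<^sup>l\<close>, and the resulting recursion has the closed form
  \<open>majorant\<close>.  At level 1 it is at most \<open>s \<rho> ^ N\<close> with \<open>\<rho> = (D + \<mu>) s / (\<mu>R) < 1\<close>.

  Third, \<open>|y\<^sub>j|\<close> decays at most like \<open>exp (- (D + \<mu>) t)\<close>, and the hypothesis on \<open>N\<close> makes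
  \<open>|v\<^sub>j / y\<^sub>j - 1| < 1/2\<close> on \<open>[0, T]\<close>.  Then \<open>\<xi>\<^sub>j = x\<^sub>j - i Ln (v\<^sub>j / y\<^sub>j)\<close>, with the principal
  logarithm, is the required phase, and \<open>|Ln (1 + z)| \<le> 2 |z|\<close> gives the estimate.
\<close>

section \<open>Differential inequalities\<close>

text \<open>A trajectory cannot climb through the strip between \<open>K\<close> and \<open>L\<close> if it never increases there:
  compare its first time at a height \<open>H\<close> inside the strip with the last earlier time at or below
  \<open>K\<close>.  The sign of \<open>\<phi>'\<close> is required inside the strip only, so the lemma also applies to a field that
  is controlled only as long as the trajectory stays below \<open>L\<close>.\<close>

lemma barrier:
  fixes \<phi> \<phi>' :: "real \<Rightarrow> real"
  assumes der: "\<And>t. t \<ge> 0 \<Longrightarrow> (\<phi> has_vector_derivative \<phi>' t) (at t within {0..})"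
    and start: "\<phi> 0 \<le> K" and "K < L"
    and down: "\<And>t. t \<ge> 0 \<Longrightarrow> K < \<phi> t \<Longrightarrow> \<phi> t < L \<Longrightarrow> \<phi>' t \<le> 0"
    and "t \<ge> 0"
  shows "\<phi> t \<le> K"
proof (rule ccontr)
  assume "\<not> \<phi> t \<le> K"
  then have "K < min L (\<phi> t)" using \<open>K < L\<close> by simp
  then obtain H where H: "K < H" "H < min L (\<phi> t)" using dense by blast
  have cont: "continuous_on S \<phi>" if "S \<subseteq> {0..}" for S
    using that der
    by (meson atLeast_iff continuous_on_eq_continuous_within continuous_on_subset
        has_vector_derivative_continuous)
  have comp: "compact ({0..b} \<inter> \<phi> -` S)" if "closed S" for b and S :: "real set"
    unfolding compact_eq_bounded_closed
    using that continuous_closed_preimage[OF cont[of "{0..b}"]]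
    by (auto intro: bounded_subset[OF bounded_closed_interval])
  have "{0..t} \<inter> \<phi> -` {H..} \<noteq> {}" using H \<open>t \<ge> 0\<close> by (auto intro!: exI[of _ t])
  then obtain b where b: "b \<in> {0..t} \<inter> \<phi> -` {H..}"
    and b_least: "\<And>r. r \<in> {0..t} \<inter> \<phi> -` {H..} \<Longrightarrow> b \<le> r"
    using compact_attains_inf[OF comp[of "{H..}" t]] by blast
  have "{0..b} \<inter> \<phi> -` {..K} \<noteq> {}" using b start by (auto intro!: exI[of _ 0])
  then obtain a where a: "a \<in> {0..b} \<inter> \<phi> -` {..K}"
    and a_greatest: "\<And>r. r \<in> {0..b} \<inter> \<phi> -` {..K} \<Longrightarrow> r \<le> a"
    using compact_attains_sup[OF comp[of "{..K}" b]] by blast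
  have "\<phi> b \<le> \<phi> a"
  proof (rule DERIV_nonpos_imp_decreasing_open[of a b \<phi>])
    show "a \<le> b" using a by simp
    show "continuous_on {a..b} \<phi>" using a by (intro cont) auto
    fix r assume r: "a < r" "r < b"
    have "(\<phi> has_vector_derivative \<phi>' r) (at r)"
      using a r has_vector_derivative_within_subset[OF der[of r], of "{0<..}"]
      by (simp add: at_within_open[of r "{0<..}"] subset_iff)
    moreover have "\<not> \<phi> r \<le> K" "\<not> H \<le> \<phi> r"
      using a_greatest[of r] b_least[of r] a b r by auto
    then have "\<phi>' r \<le> 0" using down[of r] H a r by auto
    ultimately show "\<exists>y. DERIV \<phi> r :> y \<and> y \<le> 0"
      by (auto simp: has_real_derivative_iff_has_vector_derivative)
  qed
  then show False using a b H by simp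
qed

text \<open>Outside the disc of radius \<open>A\<close> the damping \<open>m |u|\<close> dominates the forcing \<open>m A\<close>, so \<open>|u|\<^sup>2\<close>
  does not increase there.  The coefficients may be too irregular to integrate, so the variation of
  constants formula is not available and the argument uses the derivative of \<open>|u|\<^sup>2\<close> instead.\<close>

lemma linear_ode_trapped:
  fixes u c r :: "real \<Rightarrow> complex"
  assumes der: "\<And>t. t \<ge> 0 \<Longrightarrow> (u has_vector_derivative c t * u t + r t) (at t within {0..})"
    and start: "cmod (u 0) \<le> A"
    and damp: "\<And>t. t \<ge> 0 \<Longrightarrow> Re (c t) \<le> - m" and "m \<ge> 0"
    and forcing: "\<And>t. t \<ge> 0 \<Longrightarrow> cmod (r t) \<le> m * A"
    and "t \<ge> 0"
  shows "cmod (u t) \<le> A"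
proof -
  have "A \<ge> 0" using start norm_ge_zero order_trans by blast
  have "u t \<bullet> u t \<le> A\<^sup>2"
  proof (rule barrier[where L = "A\<^sup>2 + 1" and \<phi> = "\<lambda>t. u t \<bullet> u t"
        and \<phi>' = "\<lambda>t. u t \<bullet> (c t * u t + r t) + (c t * u t + r t) \<bullet> u t"])
    show "((\<lambda>t. u t \<bullet> u t) has_vector_derivative
        u t \<bullet> (c t * u t + r t) + (c t * u t + r t) \<bullet> u t) (at t within {0..})" if "t \<ge> 0" for t
      by (rule bounded_bilinear.has_vector_derivative[OF bounded_bilinear_inner der der]) (use that in auto)
    show "u 0 \<bullet> u 0 \<le> A\<^sup>2"
      using start by (simp add: dot_square_norm power_mono)
    fix t :: real assume t: "t \<ge> 0" and "A\<^sup>2 < u t \<bullet> u t"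
    then have "A\<^sup>2 \<le> (cmod (u t))\<^sup>2" by (simp add: dot_square_norm)
    then have far: "A \<le> cmod (u t)" by (rule power2_le_imp_le) simp
    have "u t \<bullet> (c t * u t) = Re (c t) * (cmod (u t))\<^sup>2"
      unfolding inner_complex_def cmod_power2 by (simp add: algebra_simps power2_eq_square)
    also have "\<dots> \<le> - m * (cmod (u t))\<^sup>2"
      using damp[OF t] by (intro mult_right_mono) auto
    finally have 1: "u t \<bullet> (c t * u t) \<le> - m * (cmod (u t))\<^sup>2" .
    have "u t \<bullet> r t \<le> cmod (u t) * cmod (r t)"
      using norm_cauchy_schwarz by blast
    also have "\<dots> \<le> cmod (u t) * (m * cmod (u t))"
      using order_trans[OF forcing[OF t] mult_left_mono[OF far \<open>m \<ge> 0\<close>]]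
      by (intro mult_left_mono) auto
    finally have "u t \<bullet> (c t * u t + r t) \<le> 0"
      using 1 by (simp add: inner_add_right power2_eq_square algebra_simps)
    then show "u t \<bullet> (c t * u t + r t) + (c t * u t + r t) \<bullet> u t \<le> 0"
      by (simp add: inner_commute)
  qed (use \<open>t \<ge> 0\<close> in auto)
  then have "(cmod (u t))\<^sup>2 \<le> A\<^sup>2" by (simp add: dot_square_norm)
  then show ?thesis using \<open>A \<ge> 0\<close> by (rule power2_le_imp_le)
qed

section \<open>Multi-indices and truncation of Fourier sums\<close>

lemma finite_mi_abs_le: "finite {\<alpha> :: int ^ 'd::finite. mi_abs \<alpha> \<le> k}"
proof (rule finite_subset)
  show "{\<alpha> :: int ^ 'd. mi_abs \<alpha> \<le> k} \<subseteq> vec_lambda ` (UNIV \<rightarrow>\<^sub>E {- int k..int k})"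
  proof
    fix \<alpha> :: "int ^ 'd" assume \<alpha>: "\<alpha> \<in> {\<alpha>. mi_abs \<alpha> \<le> k}"
    have "nat \<bar>\<alpha> $ j\<bar> \<le> k" for j
      using member_le_sum[of j UNIV "\<lambda>j. nat \<bar>\<alpha> $ j\<bar>"] \<alpha> by (simp add: mi_abs_def)
    then have "- int k \<le> \<alpha> $ j \<and> \<alpha> $ j \<le> int k" for j
      by (smt (verit) nat_le_iff)
    then show "\<alpha> \<in> vec_lambda ` (UNIV \<rightarrow>\<^sub>E {- int k..int k})"
      by (intro image_eqI[of _ _ "vec_nth \<alpha>"]) auto
  qed
qed (intro finite_imageI finite_PiE; simp)

lemma finite_mi_abs_eq: "finite {\<alpha> :: int ^ 'd::finite. mi_abs \<alpha> = k}"
  by (rule finite_subset[OF _ finite_mi_abs_le[of k]]) auto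

lemma finite_mi_level: "finite (mi_level k)"
  by (rule finite_subset[OF _ finite_mi_abs_eq[of k]]) (auto simp: mi_level_def)

text \<open>An unconditional sum is the limit of its finite partial sums, and each of these can be sorted
  by level.\<close>

lemma norm_has_sum_le_level_sums:
  fixes f :: "int ^ 'd::finite \<Rightarrow> 'a::real_normed_vector"
  assumes f: "(f has_sum S) UNIV"
    and levels: "\<And>m. (\<Sum>\<gamma> | mi_abs \<gamma> = m. norm (f \<gamma>)) \<le> b m"
    and b: "b sums B"
  shows "norm S \<le> B"
proof -
  have b0: "0 \<le> b m" for m
    using levels[of m] sum_nonneg[of "{\<gamma>. mi_abs \<gamma> = m}" "\<lambda>\<gamma>. norm (f \<gamma>)"] by force
  have "norm (sum f F) \<le> B" if "finite F" for F
  proof -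
    define M where "M = Suc (Max (mi_abs ` F))"
    have "norm (sum f F) \<le> (\<Sum>\<gamma>\<in>F. norm (f \<gamma>))" by (rule norm_sum)
    also have "\<dots> = (\<Sum>m<M. \<Sum>\<gamma> | \<gamma> \<in> F \<and> mi_abs \<gamma> = m. norm (f \<gamma>))"
      by (rule sum.group[symmetric]) (use that in \<open>auto simp: M_def less_Suc_eq_le\<close>)
    also have "\<dots> \<le> (\<Sum>m<M. b m)"
      by (intro sum_mono order_trans[OF sum_mono2 levels]) (auto intro: finite_mi_abs_eq)
    also have "\<dots> \<le> B"
      using b b0 by (metis sum_le_suminf sums_iff finite_lessThan)
    finally show ?thesis .
  qed
  then show ?thesis
    by (intro tendsto_upperbound[OF tendsto_norm[OF f[unfolded has_sum_def]]])
      (auto intro: eventually_finite_subsets_at_top_weakI)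
qed

lemma cmod_mi_dot_le:
  fixes \<alpha> :: "int ^ 'd::finite"
  shows "cmod (mi_dot \<alpha> z) \<le> real (mi_abs \<alpha>) * (\<Sum>j\<in>UNIV. cmod (z $ j))"
proof -
  have le: "real_of_int \<bar>\<alpha> $ j\<bar> \<le> real (mi_abs \<alpha>)" for j
    using member_le_sum[of j UNIV "\<lambda>j. real_of_int \<bar>\<alpha> $ j\<bar>"] by (simp add: mi_abs_def)
  have "cmod (mi_dot \<alpha> z) \<le> (\<Sum>j\<in>UNIV. cmod (of_int (\<alpha> $ j) * z $ j))"
    unfolding mi_dot_def by (rule norm_sum)
  also have "\<dots> \<le> (\<Sum>j\<in>UNIV. real (mi_abs \<alpha>) * cmod (z $ j))"
    using le by (intro sum_mono) (simp add: norm_mult mult_right_mono)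
  finally show ?thesis by (simp add: sum_distrib_left)
qed

lemma cmod_exp_mi_dot_le:
  fixes \<alpha> :: "int ^ 'd::finite"
  assumes "\<alpha> \<in> mi_nonneg" and s: "\<And>j. cmod (exp (\<i> * z $ j)) \<le> s"
  shows "cmod (exp (\<i> * mi_dot \<alpha> z)) \<le> s ^ mi_abs \<alpha>"
proof -
  have "exp (\<i> * (of_int (\<alpha> $ j) * z $ j)) = exp (\<i> * z $ j) ^ nat \<bar>\<alpha> $ j\<bar>" for j
  proof -
    obtain n where "\<alpha> $ j = int n"
      using assms(1) by (auto simp: mi_nonneg_def intro: nonneg_int_cases)
    then show ?thesis by (simp add: exp_of_nat_mult[symmetric] mult_ac)
  qed
  then have "exp (\<i> * mi_dot \<alpha> z) = (\<Prod>j\<in>UNIV. exp (\<i> * z $ j) ^ nat \<bar>\<alpha> $ j\<bar>)"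
    by (simp add: mi_dot_def sum_distrib_left exp_sum)
  also have "cmod \<dots> \<le> (\<Prod>j\<in>UNIV. s ^ nat \<bar>\<alpha> $ j\<bar>)"
    unfolding prod_norm[symmetric] norm_power using s by (intro prod_mono) (auto intro: power_mono)
  also have "\<dots> = s ^ mi_abs \<alpha>" by (simp add: mi_abs_def power_sum)
  finally show ?thesis .
qed

lemma mi_dot_add: "mi_dot (\<alpha> + \<beta>) z = mi_dot \<alpha> z + mi_dot \<beta> z"
  by (simp add: mi_dot_def algebra_simps sum.distrib)

lemma mi_abs_add: "\<alpha> \<in> mi_nonneg \<Longrightarrow> \<beta> \<in> mi_nonneg \<Longrightarrow> mi_abs (\<alpha> + \<beta>) = mi_abs \<alpha> + mi_abs \<beta>"
  by (simp add: mi_abs_def mi_nonneg_def nat_add_distrib sum.distrib)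

lemma mi_abs_eq_0_iff: "mi_abs \<alpha> = 0 \<longleftrightarrow> \<alpha> = 0"
  by (auto simp: mi_abs_def vec_eq_iff)

lemma mi_dot_axis: "mi_dot (axis j 1) z = z $ j"
  by (simp add: mi_dot_def axis_def if_distrib[of of_int] if_distrib[of "\<lambda>a. a * _"] cong: if_cong)

lemma mi_abs_axis: "mi_abs (axis j 1) = 1"
  by (simp add: mi_abs_def axis_def if_distrib[of abs] if_distrib[of nat] cong: if_cong)

lemma axis_in_mi_level: "axis j 1 \<in> mi_level 1"
  by (simp add: mi_level_def mi_abs_axis) (simp add: mi_nonneg_def axis_def)

lemma bounded_linear_mi_dot: "bounded_linear (mi_dot \<alpha>)"
  unfolding mi_dot_def
  by (intro bounded_linear_sum bounded_linear_const_mult bounded_linear_vec_nth)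

lemma mi_dot_scale: "mi_dot \<alpha> (a *s z) = a * mi_dot \<alpha> z"
  by (simp add: mi_dot_def sum_distrib_left algebra_simps)

lemma sums_geometric_tail:
  fixes q :: real
  assumes "\<bar>q\<bar> < 1"
  shows "(\<lambda>m. if m < n then 0 else C * q ^ m) sums (C * q ^ n / (1 - q))"
proof -
  have "(\<lambda>m. C * q ^ n * q ^ m) sums (C * q ^ n * (1 / (1 - q)))"
    using assms by (intro sums_mult geometric_sums) simp
  then have "(\<lambda>m. if m + n < n then 0 else C * q ^ (m + n)) sums (C * q ^ n / (1 - q))"
    by (simp add: power_add mult_ac)
  then show ?thesis
    by (subst (asm) sums_iff_shift) (simp add: sum.neutral)
qed

text \<open>The tail of the expansion of the linear form \<open>\<alpha> S\<close> from level \<open>n\<close> on is dominated by a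
  geometric series of ratio \<open>s / R\<close>.  All estimates on the field are instances: \<open>n = 0\<close> bounds the
  field, \<open>n = 1\<close> its deviation from the mean \<open>c 0\<close>, and \<open>n = N - k + 1\<close> the part of row \<open>\<alpha>\<close> that
  the finite section discards.\<close>

lemma fourier_truncation_error:
  fixes c :: "int ^ 'd::finite \<Rightarrow> complex ^ 'd"
  assumes sum: "((\<lambda>\<gamma>. exp (\<i> * mi_dot \<gamma> z) *s c \<gamma>) has_sum S) UNIV"
    and supp: "\<And>\<gamma>. \<gamma> \<notin> mi_nonneg \<Longrightarrow> c \<gamma> = 0"
    and decay: "\<And>k. (\<Sum>\<gamma> | mi_abs \<gamma> = k. \<Sum>j\<in>UNIV. cmod (c \<gamma> $ j)) \<le> D / R ^ k"
    and "R > 0" and s: "\<And>j. cmod (exp (\<i> * z $ j)) \<le> s" and "s < R"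
  shows "cmod (mi_dot \<alpha> S - (\<Sum>\<gamma> | mi_abs \<gamma> < n. exp (\<i> * mi_dot \<gamma> z) * mi_dot \<alpha> (c \<gamma>)))
    \<le> real (mi_abs \<alpha>) * D * (s / R) ^ n / (1 - s / R)"
proof -
  have "s \<ge> 0" using s norm_ge_zero order_trans by blast
  define e where "e \<gamma> = exp (\<i> * mi_dot \<gamma> z) * mi_dot \<alpha> (c \<gamma>)" for \<gamma>
  have "(e has_sum mi_dot \<alpha> S) UNIV"
    using has_sum_bounded_linear[OF bounded_linear_mi_dot sum, of \<alpha>]
    by (simp add: mi_dot_scale o_def e_def[abs_def])
  moreover have "((\<lambda>\<gamma>. if mi_abs \<gamma> < n then - e \<gamma> else 0) has_sum - (\<Sum>\<gamma> | mi_abs \<gamma> < n. e \<gamma>)) UNIV"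
    by (rule has_sum_finite_neutralI[where B = "{\<gamma>. mi_abs \<gamma> < n}"])
      (auto simp: sum_negf intro: finite_subset[OF _ finite_mi_abs_le[of n]])
  ultimately have "((\<lambda>\<gamma>. e \<gamma> + (if mi_abs \<gamma> < n then - e \<gamma> else 0)) has_sum
      (mi_dot \<alpha> S + - (\<Sum>\<gamma> | mi_abs \<gamma> < n. e \<gamma>))) UNIV"
    by (rule has_sum_add)
  then have "cmod (mi_dot \<alpha> S + - (\<Sum>\<gamma> | mi_abs \<gamma> < n. e \<gamma>))
    \<le> real (mi_abs \<alpha>) * D * (s / R) ^ n / (1 - s / R)"
  proof (rule norm_has_sum_le_level_sums)
    fix m
    have "cmod (e \<gamma>) \<le> s ^ m * real (mi_abs \<alpha>) * (\<Sum>j\<in>UNIV. cmod (c \<gamma> $ j))"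
      if "mi_abs \<gamma> = m" for \<gamma>
    proof (cases "\<gamma> \<in> mi_nonneg")
      case True
      show ?thesis
        unfolding e_def norm_mult mult.assoc
        using cmod_exp_mi_dot_le[OF True s] that \<open>s \<ge> 0\<close>
        by (intro mult_mono cmod_mi_dot_le) auto
    qed (simp add: e_def supp mi_dot_def)
    then have "(\<Sum>\<gamma> | mi_abs \<gamma> = m. cmod (e \<gamma>))
        \<le> (\<Sum>\<gamma> | mi_abs \<gamma> = m. s ^ m * real (mi_abs \<alpha>) * (\<Sum>j\<in>UNIV. cmod (c \<gamma> $ j)))"
      by (intro sum_mono) auto
    also have "\<dots> \<le> s ^ m * real (mi_abs \<alpha>) * (D / R ^ m)"
      unfolding sum_distrib_left[symmetric] using decay \<open>s \<ge> 0\<close> by (intro mult_left_mono) auto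
    finally show "(\<Sum>\<gamma> | mi_abs \<gamma> = m. cmod (e \<gamma> + (if mi_abs \<gamma> < n then - e \<gamma> else 0)))
        \<le> (if m < n then 0 else real (mi_abs \<alpha>) * D * (s / R) ^ m)"
      by (auto simp: power_divide mult_ac)
  qed (use \<open>s \<ge> 0\<close> \<open>s < R\<close> in \<open>intro sums_geometric_tail; simp\<close>)
  then show ?thesis by (simp add: e_def)
qed

section \<open>Exponentials of the state\<close>

lemma norm_cexp_sq: "(norm (cexp (\<i> *s z)))\<^sup>2 = (\<Sum>j\<in>UNIV. exp (- 2 * Im (z $ j)))"
proof -
  have "(exp a)\<^sup>2 = exp (2 * a)" for a :: real by (metis exp_double)
  then show ?thesis
    by (simp add: norm_vec_def L2_set_def cexp_def sum_nonneg)
qed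

lemma cmod_exp_le_norm_cexp: "cmod (exp (\<i> * z $ j)) \<le> norm (cexp (\<i> *s z))"
  using Finite_Cartesian_Product.norm_nth_le[of "cexp (\<i> *s z)" j] by (simp add: cexp_def)

lemma norm_cexp_pos: "0 < norm (cexp (\<i> *s z))"
  by (rule less_le_trans[OF _ cmod_exp_le_norm_cexp[of z undefined]]) simp

section \<open>The dissipative field and the rows of its Carleman-Fourier matrix\<close>

text \<open>The expansion is available on the region \<open>min Im z\<^sub>j > - ln R\<close>, written here in terms of
  \<open>exp (i z)\<close>, the variable in which the Fourier series is a power series.\<close>

locale dissipative_fourier_field =
  fixes D R \<mu> :: real
    and G :: "real \<Rightarrow> complex ^ 'd::finite \<Rightarrow> complex ^ 'd"
    and g :: "int ^ 'd \<Rightarrow> real \<Rightarrow> complex ^ 'd"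
  assumes D_pos: "D > 0" and R_pos: "R > 0" and \<mu>_pos: "\<mu> > 0"
    and supp: "\<And>t \<gamma>. t \<ge> 0 \<Longrightarrow> \<gamma> \<notin> mi_nonneg \<Longrightarrow> g \<gamma> t = 0"
    and decay: "\<And>t k. t \<ge> 0 \<Longrightarrow> (\<Sum>\<gamma> | mi_abs \<gamma> = k. \<Sum>j\<in>UNIV. cmod (g \<gamma> t $ j)) \<le> D / R ^ k"
    and damping: "\<And>t j. t \<ge> 0 \<Longrightarrow> \<mu> \<le> Im (g 0 t $ j)"
    and expansion: "\<And>t z. t \<ge> 0 \<Longrightarrow> (\<And>j. cmod (exp (\<i> * z $ j)) < R) \<Longrightarrow>
      ((\<lambda>\<gamma>. exp (\<i> * mi_dot \<gamma> z) *s g \<gamma> t) has_sum G t z) UNIV"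
begin

abbreviation radius :: real where "radius \<equiv> \<mu> * R / (D + \<mu>)"

text \<open>The threshold is the value of \<open>s\<close> at which the total weight \<open>D (s/R) / (1 - s/R)\<close> of the modes
  other than the mean reaches the damping \<open>\<mu>\<close>.\<close>

lemma below_radius:
  assumes "s < radius" "0 \<le> s"
  shows "s < R" "D * (s / R) / (1 - s / R) \<le> \<mu>" "D / (1 - s / R) \<le> D + \<mu>"
    "(1 + D / \<mu>) * (s / R) < 1"
proof -
  have le: "s * (D + \<mu>) < \<mu> * R"
    using assms(1) D_pos \<mu>_pos by (simp add: pos_less_divide_eq)
  have "s * \<mu> \<le> s * (D + \<mu>)" using assms(2) D_pos by (simp add: algebra_simps)
  then have "\<mu> * s < \<mu> * R" using le by (simp add: mult.commute)
  then show "s < R" using \<mu>_pos by simp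
  then have pos: "R - s > 0" by simp
  have r: "1 - s / R = (R - s) / R" using R_pos by (simp add: field_simps)
  show "D * (s / R) / (1 - s / R) \<le> \<mu>" "D / (1 - s / R) \<le> D + \<mu>"
    using le pos R_pos unfolding r by (simp_all add: pos_divide_le_eq algebra_simps)
  show "(1 + D / \<mu>) * (s / R) < 1"
    using le \<mu>_pos R_pos by (simp add: field_simps)
qed

lemma field_truncation_error:
  assumes "t \<ge> 0" and s: "\<And>j. cmod (exp (\<i> * z $ j)) \<le> s" and "s < R"
  shows "cmod (mi_dot \<alpha> (G t z) - (\<Sum>\<gamma> | mi_abs \<gamma> < n. exp (\<i> * mi_dot \<gamma> z) * mi_dot \<alpha> (g \<gamma> t)))
    \<le> real (mi_abs \<alpha>) * D * (s / R) ^ n / (1 - s / R)"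
  by (rule fourier_truncation_error[OF expansion supp decay R_pos s \<open>s < R\<close>])
    (use assms in \<open>auto intro: le_less_trans\<close>)

text \<open>The mean dominates all other modes inside the threshold.  The lower bound traps solutions; the
  upper bound limits how fast \<open>exp (i x\<^sub>j)\<close> can decay.\<close>

lemma Im_field_bounds:
  assumes "t \<ge> 0" and s: "\<And>j. cmod (exp (\<i> * z $ j)) \<le> s" and "s < radius"
  shows "0 \<le> Im (G t z $ j)" "Im (G t z $ j) \<le> D + \<mu>"
proof -
  have "0 \<le> s" using s norm_ge_zero order_trans by blast
  note rad = below_radius[OF \<open>s < radius\<close> \<open>0 \<le> s\<close>]
  have "cmod (G t z $ j) \<le> D / (1 - s / R)"
    using field_truncation_error[OF \<open>t \<ge> 0\<close> s rad(1), of "axis j 1" 0]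
    by (simp add: mi_dot_axis mi_abs_axis)
  then show "Im (G t z $ j) \<le> D + \<mu>"
    using rad(3) abs_Im_le_cmod[of "G t z $ j"] by linarith
  have "{\<gamma> :: int ^ 'd. mi_abs \<gamma> < 1} = {0}" by (auto simp: mi_abs_eq_0_iff)
  moreover have "mi_dot 0 z = 0" by (simp add: mi_dot_def)
  ultimately have "cmod (G t z $ j - g 0 t $ j) \<le> D * (s / R) / (1 - s / R)"
    using field_truncation_error[OF \<open>t \<ge> 0\<close> s rad(1), of "axis j 1" 1]
    by (simp add: mi_dot_axis mi_abs_axis)
  then show "0 \<le> Im (G t z $ j)"
    using rad(2) damping[OF \<open>t \<ge> 0\<close>, of j] abs_Im_le_cmod[of "G t z $ j - g 0 t $ j"] by simp
qed

lemma cf_entry_eq_0: "t \<ge> 0 \<Longrightarrow> \<beta> - \<alpha> \<notin> mi_nonneg \<Longrightarrow> cf_entry g t \<alpha> \<beta> = 0"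
  by (simp add: cf_entry_def supp mi_dot_def)

text \<open>For \<open>\<alpha>\<close> and \<open>\<beta> - \<alpha>\<close> in the nonnegative orthant the levels add, so row \<open>\<alpha>\<close> of the block
  \<open>(k, l)\<close> only sees Fourier modes of level \<open>l - k\<close>.\<close>

lemma row_sum_le:
  assumes "t \<ge> 0" and "\<alpha> \<in> mi_level k" and "k \<le> l"
  shows "(\<Sum>\<beta>\<in>mi_level l. cmod (cf_entry g t \<alpha> \<beta>)) \<le> real k * (D / R ^ (l - k))"
proof -
  define B where "B = {\<beta> \<in> mi_level l. \<beta> - \<alpha> \<in> mi_nonneg}"
  have \<alpha>: "\<alpha> \<in> mi_nonneg" "mi_abs \<alpha> = k" using assms(2) by (auto simp: mi_level_def)
  have abs: "mi_abs (\<beta> - \<alpha>) = l - k" if "\<beta> \<in> B" for \<beta>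
    using mi_abs_add[OF \<alpha>(1), of "\<beta> - \<alpha>"] that \<alpha>(2) by (auto simp: B_def mi_level_def)
  have "(\<Sum>\<beta>\<in>mi_level l. cmod (cf_entry g t \<alpha> \<beta>)) = (\<Sum>\<beta>\<in>B. cmod (cf_entry g t \<alpha> \<beta>))"
    by (rule sum.mono_neutral_right) (auto simp: B_def finite_mi_level intro: cf_entry_eq_0[OF \<open>t \<ge> 0\<close>])
  also have "\<dots> = (\<Sum>\<beta>\<in>B. cmod (mi_dot \<alpha> (g (\<beta> - \<alpha>) t)))"
    by (simp add: cf_entry_def norm_mult)
  also have "\<dots> = (\<Sum>\<gamma>\<in>(\<lambda>\<beta>. \<beta> - \<alpha>) ` B. cmod (mi_dot \<alpha> (g \<gamma> t)))"
    by (subst sum.reindex) (auto simp: inj_on_def)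
  also have "\<dots> \<le> (\<Sum>\<gamma> | mi_abs \<gamma> = l - k. cmod (mi_dot \<alpha> (g \<gamma> t)))"
    using abs by (intro sum_mono2 finite_mi_abs_eq) auto
  also have "\<dots> \<le> (\<Sum>\<gamma> | mi_abs \<gamma> = l - k. real k * (\<Sum>j\<in>UNIV. cmod (g \<gamma> t $ j)))"
    using cmod_mi_dot_le[of \<alpha>] \<alpha>(2) by (intro sum_mono) simp
  also have "\<dots> \<le> real k * (D / R ^ (l - k))"
    unfolding sum_distrib_left[symmetric] by (intro mult_left_mono decay \<open>t \<ge> 0\<close>) simp
  finally show ?thesis .
qed

lemma diagonal_row:
  assumes "t \<ge> 0" and "\<alpha> \<in> mi_level k"
  shows "(\<Sum>\<beta>\<in>mi_level k. cf_entry g t \<alpha> \<beta> * f \<beta>) = \<i> * mi_dot \<alpha> (g 0 t) * f \<alpha>"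
proof -
  have "cf_entry g t \<alpha> \<beta> = 0" if "\<beta> \<in> mi_level k" "\<beta> \<noteq> \<alpha>" for \<beta>
  proof (cases "\<beta> - \<alpha> \<in> mi_nonneg")
    case True
    then have "mi_abs (\<beta> - \<alpha>) = 0"
      using mi_abs_add[of \<alpha> "\<beta> - \<alpha>"] that assms(2) by (auto simp: mi_level_def)
    then show ?thesis using that by (simp add: mi_abs_eq_0_iff)
  qed (rule cf_entry_eq_0[OF \<open>t \<ge> 0\<close>])
  then have "(\<Sum>\<beta>\<in>mi_level k. cf_entry g t \<alpha> \<beta> * f \<beta>) = (\<Sum>\<beta>\<in>{\<alpha>}. cf_entry g t \<alpha> \<beta> * f \<beta>)"
    using assms(2) by (intro sum.mono_neutral_right finite_mi_level) auto
  then show ?thesis by (simp add: cf_entry_def)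
qed

lemma damping_mi_dot:
  assumes "t \<ge> 0" and "\<alpha> \<in> mi_level k"
  shows "Re (\<i> * mi_dot \<alpha> (g 0 t)) \<le> - (real k * \<mu>)"
proof -
  have nonneg: "0 \<le> \<alpha> $ j" for j using assms(2) by (simp add: mi_level_def mi_nonneg_def)
  have "real k * \<mu> = (\<Sum>j\<in>UNIV. real_of_int (\<alpha> $ j) * \<mu>)"
    using assms(2) nonneg by (auto simp: mi_level_def mi_abs_def sum_distrib_right)
  also have "\<dots> \<le> (\<Sum>j\<in>UNIV. real_of_int (\<alpha> $ j) * Im (g 0 t $ j))"
    using nonneg damping[OF \<open>t \<ge> 0\<close>] by (intro sum_mono mult_left_mono) auto
  finally show ?thesis by (simp add: mi_dot_def)
qed

text \<open>Since \<open>w\<^sub>\<alpha> w\<^sub>\<gamma> = w\<^sub>\<alpha>\<^sub>+\<^sub>\<gamma>\<close>, applying the truncated row \<open>\<alpha>\<close> to the monomials amounts to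
  truncating the Fourier series of the field: the column \<open>\<beta> = \<alpha> + \<gamma>\<close> is kept exactly when
  \<open>|\<gamma>| \<le> N - k\<close>.\<close>

lemma resummed_row:
  assumes "t \<ge> 0" and "\<alpha> \<in> mi_level k" and "k \<le> N"
  shows "(\<Sum>l=k..N. \<Sum>\<beta>\<in>mi_level l. cf_entry g t \<alpha> \<beta> * exp (\<i> * mi_dot \<beta> z))
    = \<i> * (\<Sum>\<gamma> | mi_abs \<gamma> < Suc N - k. exp (\<i> * mi_dot \<gamma> z) * mi_dot \<alpha> (g \<gamma> t)) * exp (\<i> * mi_dot \<alpha> z)"
proof -
  define h where "h \<beta> = cf_entry g t \<alpha> \<beta> * exp (\<i> * mi_dot \<beta> z)" for \<beta>
  define \<Gamma> :: "(int ^ 'd) set" where "\<Gamma> = {\<gamma> \<in> mi_nonneg. mi_abs \<gamma> < Suc N - k}"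
  have \<alpha>: "\<alpha> \<in> mi_nonneg" "mi_abs \<alpha> = k" using assms(2) by (auto simp: mi_level_def)
  have nonneg_add: "\<alpha> + \<gamma> \<in> mi_nonneg" if "\<gamma> \<in> mi_nonneg" for \<gamma>
    using that \<alpha>(1) by (simp add: mi_nonneg_def)
  have "(\<Sum>l=k..N. \<Sum>\<beta>\<in>mi_level l. h \<beta>) = (\<Sum>\<beta>\<in>(\<Union>l\<in>{k..N}. mi_level l). h \<beta>)"
    by (rule sum.UNION_disjoint[symmetric]) (simp_all add: finite_mi_level, auto simp: mi_level_def)
  also have "\<dots> = (\<Sum>\<beta>\<in>(+) \<alpha> ` \<Gamma>. h \<beta>)"
  proof (rule sum.mono_neutral_right)
    show "(+) \<alpha> ` \<Gamma> \<subseteq> (\<Union>l\<in>{k..N}. mi_level l)"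
      using \<alpha> nonneg_add by (auto simp: \<Gamma>_def mi_level_def mi_abs_add)
    show "\<forall>\<beta>\<in>(\<Union>l\<in>{k..N}. mi_level l) - (+) \<alpha> ` \<Gamma>. h \<beta> = 0"
    proof
      fix \<beta> assume \<beta>: "\<beta> \<in> (\<Union>l\<in>{k..N}. mi_level l) - (+) \<alpha> ` \<Gamma>"
      have "\<beta> - \<alpha> \<notin> mi_nonneg"
      proof
        assume nn: "\<beta> - \<alpha> \<in> mi_nonneg"
        have "mi_abs \<beta> = k + mi_abs (\<beta> - \<alpha>)" using mi_abs_add[OF \<alpha>(1) nn] \<alpha>(2) by simp
        moreover have "mi_abs \<beta> \<le> N" using \<beta> by (auto simp: mi_level_def)
        ultimately have "\<beta> - \<alpha> \<in> \<Gamma>" using nn by (simp add: \<Gamma>_def)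
        then have "\<alpha> + (\<beta> - \<alpha>) \<in> (+) \<alpha> ` \<Gamma>" by (rule imageI)
        then show False using \<beta> by simp
      qed
      then show "h \<beta> = 0" by (simp add: h_def cf_entry_eq_0[OF \<open>t \<ge> 0\<close>])
    qed
  qed (simp add: finite_mi_level)
  also have "\<dots> = (\<Sum>\<gamma>\<in>\<Gamma>. h (\<alpha> + \<gamma>))"
    by (subst sum.reindex) auto
  also have "\<dots> = (\<Sum>\<gamma> | mi_abs \<gamma> < Suc N - k. h (\<alpha> + \<gamma>))"
    by (rule sum.mono_neutral_left)
      (auto simp: \<Gamma>_def h_def intro: cf_entry_eq_0[OF \<open>t \<ge> 0\<close>] finite_subset[OF _ finite_mi_abs_le[of N]])
  also have "\<dots> = \<i> * (\<Sum>\<gamma> | mi_abs \<gamma> < Suc N - k. exp (\<i> * mi_dot \<gamma> z) * mi_dot \<alpha> (g \<gamma> t)) * exp (\<i> * mi_dot \<alpha> z)"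
    by (simp add: h_def cf_entry_def mi_dot_add exp_add distrib_left sum_distrib_left sum_distrib_right mult_ac)
  finally show ?thesis by (simp add: h_def)
qed

end

section \<open>Solutions and their monomials\<close>

locale carleman_fourier = dissipative_fourier_field D R \<mu> G g
  for D R \<mu> :: real and G :: "real \<Rightarrow> complex ^ 'd::finite \<Rightarrow> complex ^ 'd"
    and g :: "int ^ 'd \<Rightarrow> real \<Rightarrow> complex ^ 'd" +
  fixes x0 :: "complex ^ 'd" and x :: "real \<Rightarrow> complex ^ 'd"
  assumes solution: "solves_ode_from G x0 x"
    and small: "norm (cexp (\<i> *s x0)) < radius"
begin

abbreviation s :: real where "s \<equiv> norm (cexp (\<i> *s x0))"

lemma start: "x 0 = x0"
  using solution by (simp add: solves_ode_from_def)

lemma mi_dot_solution_derivative: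
  "t \<ge> 0 \<Longrightarrow> ((\<lambda>t. mi_dot \<alpha> (x t)) has_vector_derivative mi_dot \<alpha> (G t (x t))) (at t within {0..})"
  using solution unfolding solves_ode_from_def
  by (intro bounded_linear.has_vector_derivative[OF bounded_linear_mi_dot]) simp

lemma Im_solution_derivative:
  assumes "t \<ge> 0"
  shows "((\<lambda>t. Im (x t $ j)) has_real_derivative Im (G t (x t) $ j)) (at t within {0..})"
  using bounded_linear.has_vector_derivative[OF bounded_linear_Im
      mi_dot_solution_derivative[OF assms, of "axis j 1"]]
  by (simp add: mi_dot_axis has_real_derivative_iff_has_vector_derivative)

text \<open>Inside the threshold every \<open>Im x\<^sub>j\<close> is nondecreasing, and the Euclidean norm is used because its
  square is differentiable.  The barrier lemma with \<open>L = radius\<^sup>2\<close> excludes the escape into the region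
  where nothing is known about the field.\<close>

lemma solution_trapped:
  assumes "t \<ge> 0"
  shows "norm (cexp (\<i> *s x t)) \<le> s"
proof -
  have "(\<Sum>j\<in>UNIV. exp (- 2 * Im (x t $ j))) \<le> s\<^sup>2"
  proof (rule barrier[where L = "radius\<^sup>2" and \<phi> = "\<lambda>t. \<Sum>j\<in>UNIV. exp (- 2 * Im (x t $ j))"
        and \<phi>' = "\<lambda>t. \<Sum>j\<in>UNIV. - 2 * Im (G t (x t) $ j) * exp (- 2 * Im (x t $ j))"])
    show "((\<lambda>t. \<Sum>j\<in>UNIV. exp (- 2 * Im (x t $ j))) has_vector_derivative
        (\<Sum>j\<in>UNIV. - 2 * Im (G t (x t) $ j) * exp (- 2 * Im (x t $ j)))) (at t within {0..})"
      if "t \<ge> 0" for t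
      unfolding has_real_derivative_iff_has_vector_derivative[symmetric]
      by (rule derivative_eq_intros Im_solution_derivative that refl)+ (simp add: algebra_simps)
    show "(\<Sum>j\<in>UNIV. exp (- 2 * Im (x 0 $ j))) \<le> s\<^sup>2"
      by (simp only: start norm_cexp_sq)
    show "s\<^sup>2 < radius\<^sup>2" using small by (intro power_strict_mono) auto
    fix t :: real assume "t \<ge> 0" "(\<Sum>j\<in>UNIV. exp (- 2 * Im (x t $ j))) < radius\<^sup>2"
    then have "(norm (cexp (\<i> *s x t)))\<^sup>2 < radius\<^sup>2" by (simp only: norm_cexp_sq)
    then have "norm (cexp (\<i> *s x t)) < radius"
      by (rule power2_less_imp_less) (use D_pos R_pos \<mu>_pos in simp)
    then have "0 \<le> Im (G t (x t) $ j)" for j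
      using Im_field_bounds(1)[OF \<open>t \<ge> 0\<close> cmod_exp_le_norm_cexp] by blast
    then show "(\<Sum>j\<in>UNIV. - 2 * Im (G t (x t) $ j) * exp (- 2 * Im (x t $ j))) \<le> 0"
      by (intro sum_nonpos) (simp add: mult_nonneg_nonneg)
  qed (use assms in auto)
  then have "(norm (cexp (\<i> *s x t)))\<^sup>2 \<le> s\<^sup>2" by (simp only: norm_cexp_sq)
  then show ?thesis by (rule power2_le_imp_le) simp
qed

lemma solution_components_trapped:
  "t \<ge> 0 \<Longrightarrow> cmod (exp (\<i> * x t $ j)) \<le> s"
  using cmod_exp_le_norm_cexp solution_trapped order_trans by blast

lemma Im_solution_le:
  assumes "t \<ge> 0"
  shows "Im (x t $ j) \<le> Im (x0 $ j) + (D + \<mu>) * t"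
proof -
  have "Im (x t $ j) - (D + \<mu>) * t \<le> Im (x0 $ j)"
  proof (rule barrier[where \<phi> = "\<lambda>t. Im (x t $ j) - (D + \<mu>) * t" and L = "Im (x0 $ j) + 1"
        and \<phi>' = "\<lambda>t. Im (G t (x t) $ j) - (D + \<mu>)"])
    show "((\<lambda>t. Im (x t $ j) - (D + \<mu>) * t) has_vector_derivative Im (G t (x t) $ j) - (D + \<mu>))
        (at t within {0..})" if "t \<ge> 0" for t
      unfolding has_real_derivative_iff_has_vector_derivative[symmetric]
      by (rule derivative_eq_intros Im_solution_derivative that refl)+ simp
    show "Im (G t (x t) $ j) - (D + \<mu>) \<le> 0" if "t \<ge> 0" for t
      using Im_field_bounds(2)[OF that solution_components_trapped[OF that] small, of j] by simp
  qed (use assms start in auto)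
  then show ?thesis by simp
qed

lemma monomial_derivative:
  assumes "t \<ge> 0"
  shows "((\<lambda>t. exp (\<i> * mi_dot \<alpha> (x t))) has_vector_derivative
    \<i> * mi_dot \<alpha> (G t (x t)) * exp (\<i> * mi_dot \<alpha> (x t))) (at t within {0..})"
proof -
  have "((\<lambda>t. \<i> * mi_dot \<alpha> (x t)) has_vector_derivative \<i> * mi_dot \<alpha> (G t (x t))) (at t within {0..})"
    by (intro has_vector_derivative_mult_right mi_dot_solution_derivative assms)
  from field_vector_diff_chain_within[OF this, of exp]
  show ?thesis by (simp add: o_def DERIV_exp has_field_derivative_at_within)
qed

text \<open>The monomials fail to solve the finite section only by the discarded Fourier tail times
  \<open>w\<^sub>\<alpha>\<close>.  The two factors carry \<open>(s/R) ^ (N + 1 - k)\<close> and \<open>s ^ k\<close>; together they make the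
  smallness \<open>(s/R) ^ (N + 1)\<close> the same on every level.\<close>

lemma truncation_defect:
  assumes "t \<ge> 0" and "\<alpha> \<in> mi_level k" and "k \<le> N"
  shows "cmod ((\<Sum>l=k..N. \<Sum>\<beta>\<in>mi_level l. cf_entry g t \<alpha> \<beta> * exp (\<i> * mi_dot \<beta> (x t)))
      - \<i> * mi_dot \<alpha> (G t (x t)) * exp (\<i> * mi_dot \<alpha> (x t)))
    \<le> real k * D * (s / R) ^ Suc N / (1 - s / R) * R ^ k"
proof -
  note rad = below_radius[OF small norm_ge_zero]
  have \<alpha>: "\<alpha> \<in> mi_nonneg" "mi_abs \<alpha> = k" using assms(2) by (auto simp: mi_level_def)
  define P where "P = (\<Sum>\<gamma> | mi_abs \<gamma> < Suc N - k. exp (\<i> * mi_dot \<gamma> (x t)) * mi_dot \<alpha> (g \<gamma> t))"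
  define w where "w = exp (\<i> * mi_dot \<alpha> (x t))"
  have "(\<Sum>l=k..N. \<Sum>\<beta>\<in>mi_level l. cf_entry g t \<alpha> \<beta> * exp (\<i> * mi_dot \<beta> (x t)))
      - \<i> * mi_dot \<alpha> (G t (x t)) * w = - (\<i> * (mi_dot \<alpha> (G t (x t)) - P) * w)"
    unfolding resummed_row[OF assms] P_def[symmetric] w_def[symmetric] by (simp add: algebra_simps)
  then have "cmod ((\<Sum>l=k..N. \<Sum>\<beta>\<in>mi_level l. cf_entry g t \<alpha> \<beta> * exp (\<i> * mi_dot \<beta> (x t)))
      - \<i> * mi_dot \<alpha> (G t (x t)) * w) = cmod (mi_dot \<alpha> (G t (x t)) - P) * cmod w"
    by (simp add: norm_mult)
  also have "\<dots> \<le> real k * D * (s / R) ^ (Suc N - k) / (1 - s / R) * s ^ k"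
    using field_truncation_error[OF assms(1) solution_components_trapped[OF assms(1)] rad(1), of \<alpha> "Suc N - k"]
      cmod_exp_mi_dot_le[OF \<alpha>(1) solution_components_trapped[OF assms(1)]] \<alpha>(2)
    by (intro mult_mono') (auto simp: P_def w_def)
  also have "s ^ k = (s / R) ^ k * R ^ k" using R_pos by (simp add: power_divide)
  also have "real k * D * (s / R) ^ (Suc N - k) / (1 - s / R) * ((s / R) ^ k * R ^ k)
      = real k * D * ((s / R) ^ (Suc N - k) * (s / R) ^ k) / (1 - s / R) * R ^ k" by simp
  also have "(s / R) ^ (Suc N - k) * (s / R) ^ k = (s / R) ^ Suc N"
    using assms(3) by (simp add: power_add[symmetric])
  finally show ?thesis by (simp add: w_def)
qed

end

section \<open>Error of the finite section\<close>

lemma sum_geometric_tail: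
  fixes q :: real
  assumes "k \<le> N"
  shows "(\<Sum>l=Suc k..N. q ^ (N - l) * (q - 1)) = q ^ (N - k) - 1"
  using assms
proof (induction k rule: inc_induct)
  case (step k)
  then have "q ^ (N - k) = q * q ^ (N - Suc k)"
    by (metis Suc_diff_Suc power_Suc)
  moreover have "(\<Sum>l=Suc k..N. q ^ (N - l) * (q - 1))
      = q ^ (N - Suc k) * (q - 1) + (\<Sum>l=Suc (Suc k)..N. q ^ (N - l) * (q - 1))"
    using step.hyps by (intro sum.atLeast_Suc_atMost) simp
  ultimately show ?case using step.IH by (simp add: algebra_simps)
qed simp

context carleman_fourier
begin

text \<open>The solution of the downward recursion \<open>majorant_recursion\<close>, in which the bound on level \<open>k\<close>
  balances the damping against the forcing from higher levels and from the truncation defect.\<close>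

definition majorant :: "nat \<Rightarrow> nat \<Rightarrow> real" where
  "majorant N k = R ^ k * (1 + D / \<mu>) ^ (N - k) * (D / \<mu>) * ((s / R) ^ Suc N / (1 - s / R))"

lemma majorant_nonneg: "0 \<le> majorant N k"
  using D_pos R_pos \<mu>_pos below_radius(1)[OF small norm_ge_zero]
  by (simp add: majorant_def)

text \<open>After division by \<open>R ^ k\<close> the forcing from level \<open>l\<close> does not depend on \<open>k\<close>, so each step down
  multiplies the rescaled bound by \<open>1 + D / \<mu>\<close>.\<close>

lemma majorant_recursion:
  assumes "k \<le> N"
  shows "(\<Sum>l=Suc k..N. D / R ^ (l - k) * majorant N l) + D * (s / R) ^ Suc N / (1 - s / R) * R ^ k
    = \<mu> * majorant N k"
proof -
  define E where "E = (s / R) ^ Suc N / (1 - s / R)"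
  define q where "q = 1 + D / \<mu>"
  have m: "majorant N l = R ^ l * q ^ (N - l) * (q - 1) * E" for l
    by (simp add: majorant_def E_def q_def)
  have "D / R ^ (l - k) * majorant N l = D * R ^ k * E * (q ^ (N - l) * (q - 1))"
    if "l \<in> {Suc k..N}" for l
  proof -
    have "R ^ l = R ^ (l - k) * R ^ k" using that by (simp add: power_add[symmetric])
    then show ?thesis using R_pos by (simp add: m)
  qed
  then have "(\<Sum>l=Suc k..N. D / R ^ (l - k) * majorant N l) = D * R ^ k * E * (q ^ (N - k) - 1)"
    by (simp add: sum_geometric_tail[OF assms, symmetric] sum_distrib_left)
  moreover have "D * (s / R) ^ Suc N / (1 - s / R) * R ^ k = D * R ^ k * E" by (simp add: E_def)
  moreover have "\<mu> * (q - 1) = D" using \<mu>_pos by (simp add: q_def)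
  then have "\<mu> * majorant N k = D * R ^ k * E * q ^ (N - k)" by (simp add: m mult_ac)
  ultimately show ?thesis by (simp add: algebra_simps)
qed

text \<open>Each of the \<open>N - 1\<close> factors \<open>1 + D / \<mu>\<close> is paid for by one of the \<open>N + 1\<close> factors \<open>s / R\<close>.  One of
  the two remaining factors, together with \<open>R\<close>, is \<open>s\<close>; the other supplies the last factor of \<open>\<rho> ^ N\<close>,
  as \<open>(D / \<mu>) / (1 - s / R) \<le> 1 + D / \<mu>\<close> below the threshold.\<close>

lemma majorant_first_level:
  assumes "N \<ge> 1"
  shows "majorant N 1 \<le> s * ((D + \<mu>) * s / (\<mu> * R)) ^ N"
proof -
  define q where "q = 1 + D / \<mu>"
  define \<sigma> where "\<sigma> = s / R"
  obtain M where M: "N = Suc M" using assms by (cases N) auto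
  note rad = below_radius[OF small norm_ge_zero]
  have q: "q > 0" "q - 1 > 0" and \<sigma>: "0 \<le> \<sigma>" "\<sigma> < 1" "q * \<sigma> < 1"
    using D_pos \<mu>_pos R_pos rad by (auto simp: q_def \<sigma>_def intro: add_pos_pos)
  have "(q - 1) / (1 - \<sigma>) \<le> q"
    using \<sigma> by (simp add: pos_divide_le_eq algebra_simps)
  then have "R * q ^ M * \<sigma> ^ Suc N * ((q - 1) / (1 - \<sigma>)) \<le> R * q ^ M * \<sigma> ^ Suc N * q"
    using R_pos q \<sigma> by (intro mult_left_mono) auto
  moreover have "majorant N 1 = R * q ^ M * \<sigma> ^ Suc N * ((q - 1) / (1 - \<sigma>))"
    unfolding majorant_def \<sigma>_def[symmetric] by (simp add: q_def M mult_ac)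
  moreover have "R * q ^ M * \<sigma> ^ Suc N * q = R * \<sigma> * (q * \<sigma>) ^ N"
    by (simp add: M power_mult_distrib mult_ac)
  moreover have "R * \<sigma> = s" using R_pos by (simp add: \<sigma>_def)
  moreover have "(D + \<mu>) * s / (\<mu> * R) = q * \<sigma>"
    using \<mu>_pos R_pos by (simp add: q_def \<sigma>_def field_simps)
  ultimately show ?thesis by metis
qed

text \<open>Descending induction on the level: the block is triangular, so once the errors on all higher
  levels are bounded, each error on level \<open>k\<close> obeys a scalar damped equation whose forcing is at
  most \<open>k \<mu>\<close> times the majorant.\<close>

lemma finite_section_error:
  assumes v: "finite_section_approx g x0 N v"
    and "1 \<le> k" "k \<le> N" "\<alpha> \<in> mi_level k" "t \<ge> 0"
  shows "cmod (v k \<alpha> t - exp (\<i> * mi_dot \<alpha> (x t))) \<le> majorant N k"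
  using assms(2-5)
proof (induction "N - k" arbitrary: k \<alpha> t rule: less_induct)
  case less
  define w where "w \<beta> t = exp (\<i> * mi_dot \<beta> (x t))" for \<beta> t
  define f where "f l t = (\<Sum>\<beta>\<in>mi_level l. cf_entry g t \<alpha> \<beta> * (v l \<beta> t - w \<beta> t))" for l t
  define defect where "defect t = (\<Sum>l=k..N. \<Sum>\<beta>\<in>mi_level l. cf_entry g t \<alpha> \<beta> * w \<beta> t)
      - \<i> * mi_dot \<alpha> (G t (x t)) * w \<alpha> t" for t
  \<comment> \<open>Everything in the error equation that is not the diagonal term.\<close>
  define r where "r t = (\<Sum>l=Suc k..N. f l t) + defect t" for t
  show ?case
    unfolding w_def[symmetric]
  proof (rule linear_ode_trapped[where u = "\<lambda>t. v k \<alpha> t - w \<alpha> t" and r = r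
        and c = "\<lambda>t. \<i> * mi_dot \<alpha> (g 0 t)" and m = "real k * \<mu>"])
    fix t :: real assume t: "t \<ge> 0"
    have "((\<lambda>t. v k \<alpha> t - w \<alpha> t) has_vector_derivative
        (\<Sum>l=k..N. \<Sum>\<beta>\<in>mi_level l. cf_entry g t \<alpha> \<beta> * v l \<beta> t)
        - \<i> * mi_dot \<alpha> (G t (x t)) * w \<alpha> t) (at t within {0..})"
      unfolding w_def using v less.prems t
      by (intro has_vector_derivative_diff monomial_derivative) (auto simp: finite_section_approx_def)
    moreover have "(\<Sum>l=k..N. \<Sum>\<beta>\<in>mi_level l. cf_entry g t \<alpha> \<beta> * v l \<beta> t)
        - \<i> * mi_dot \<alpha> (G t (x t)) * w \<alpha> t = (\<Sum>l=k..N. f l t) + defect t"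
      by (simp add: defect_def f_def sum_subtractf right_diff_distrib)
    moreover have "(\<Sum>l=k..N. f l t) = f k t + (\<Sum>l=Suc k..N. f l t)"
      using less.prems by (intro sum.atLeast_Suc_atMost)
    moreover have "f k t = \<i> * mi_dot \<alpha> (g 0 t) * (v k \<alpha> t - w \<alpha> t)"
      unfolding f_def by (rule diagonal_row[OF t less.prems(3)])
    ultimately show "((\<lambda>t. v k \<alpha> t - w \<alpha> t) has_vector_derivative
        \<i> * mi_dot \<alpha> (g 0 t) * (v k \<alpha> t - w \<alpha> t) + r t) (at t within {0..})"
      by (simp add: r_def add.assoc)
    have "cmod (f l t) \<le> real k * (D / R ^ (l - k)) * majorant N l" if l: "l \<in> {Suc k..N}" for l
    proof -
      have "cmod (f l t) \<le> (\<Sum>\<beta>\<in>mi_level l. cmod (cf_entry g t \<alpha> \<beta>) * majorant N l)"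
        unfolding f_def w_def using less.hyps[of l] less.prems l t
        by (intro sum_norm_le) (auto simp: norm_mult intro!: mult_left_mono)
      also have "\<dots> \<le> real k * (D / R ^ (l - k)) * majorant N l"
        unfolding sum_distrib_right[symmetric] using l
        by (intro mult_right_mono row_sum_le[OF t less.prems(3)] majorant_nonneg) auto
      finally show ?thesis .
    qed
    then have "cmod (\<Sum>l=Suc k..N. f l t) \<le> (\<Sum>l=Suc k..N. real k * (D / R ^ (l - k)) * majorant N l)"
      by (intro sum_norm_le)
    moreover have "cmod (defect t) \<le> real k * D * (s / R) ^ Suc N / (1 - s / R) * R ^ k"
      unfolding defect_def w_def by (rule truncation_defect[OF t less.prems(3,2)])
    ultimately have "cmod (r t) \<le> (\<Sum>l=Suc k..N. real k * (D / R ^ (l - k)) * majorant N l)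
        + real k * D * (s / R) ^ Suc N / (1 - s / R) * R ^ k"
      unfolding r_def by (intro norm_triangle_le add_mono)
    also have "\<dots> = real k * ((\<Sum>l=Suc k..N. D / R ^ (l - k) * majorant N l)
        + D * (s / R) ^ Suc N / (1 - s / R) * R ^ k)"
      by (simp add: sum_distrib_left distrib_left mult.assoc)
    also have "\<dots> = real k * \<mu> * majorant N k"
      unfolding majorant_recursion[OF less.prems(2)] by simp
    finally show "cmod (r t) \<le> real k * \<mu> * majorant N k" .
    show "Re (\<i> * mi_dot \<alpha> (g 0 t)) \<le> - (real k * \<mu>)"
      by (rule damping_mi_dot[OF t less.prems(3)])
  next
    show "cmod (v k \<alpha> 0 - w \<alpha> 0) \<le> majorant N k"
      using v less.prems majorant_nonneg by (auto simp: finite_section_approx_def w_def start)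
  qed (use less.prems \<mu>_pos in auto)
qed

text \<open>The absolute error is bounded uniformly in time; the exponential factor only measures how far
  the exact entry \<open>exp (i x\<^sub>j)\<close> itself may have decayed.\<close>

lemma relative_error:
  assumes v: "finite_section_approx g x0 N v" and "N \<ge> 1" and "t \<ge> 0"
  shows "cmod (v 1 (axis j 1) t / exp (\<i> * x t $ j) - 1)
    \<le> s * sup_norm (cexp (- (\<i> *s x0))) * ((D + \<mu>) * s / (\<mu> * R)) ^ N * exp ((D + \<mu>) * t)"
proof -
  define y where "y = exp (\<i> * x t $ j)"
  have "cmod (v 1 (axis j 1) t - y) \<le> s * ((D + \<mu>) * s / (\<mu> * R)) ^ N"
    using order_trans[OF finite_section_error[OF v order_refl \<open>N \<ge> 1\<close> axis_in_mi_level \<open>t \<ge> 0\<close>]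
        majorant_first_level[OF \<open>N \<ge> 1\<close>], of j]
    unfolding mi_dot_axis y_def .
  moreover have "inverse (cmod y) \<le> sup_norm (cexp (- (\<i> *s x0))) * exp ((D + \<mu>) * t)"
  proof -
    have "inverse (cmod y) = exp (Im (x t $ j))" by (simp add: y_def exp_minus[symmetric])
    also have "\<dots> \<le> exp (Im (x0 $ j)) * exp ((D + \<mu>) * t)"
      using Im_solution_le[OF \<open>t \<ge> 0\<close>] by (simp add: exp_add[symmetric])
    also have "exp (Im (x0 $ j)) = cmod (cexp (- (\<i> *s x0)) $ j)" by (simp add: cexp_def)
    also have "\<dots> \<le> sup_norm (cexp (- (\<i> *s x0)))"
      unfolding sup_norm_def by (rule Max_ge) auto
    finally show ?thesis by simp
  qed
  ultimately have "cmod (v 1 (axis j 1) t - y) * inverse (cmod y)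
      \<le> s * ((D + \<mu>) * s / (\<mu> * R)) ^ N * (sup_norm (cexp (- (\<i> *s x0))) * exp ((D + \<mu>) * t))"
    by (intro mult_mono') auto
  moreover have "v 1 (axis j 1) t / y - 1 = (v 1 (axis j 1) t - y) * inverse y"
    by (simp add: y_def field_simps)
  ultimately show ?thesis
    unfolding y_def[symmetric] by (simp only: norm_mult norm_inverse mult_ac)
qed

end

section \<open>Phases of the first block\<close>

theorem corollary3p4:
  fixes D0 R \<mu>0 T :: real
    and G :: "real \<Rightarrow> complex ^ 'd::finite \<Rightarrow> complex ^ 'd"
    and g :: "int ^ 'd \<Rightarrow> real \<Rightarrow> complex ^ 'd"
    and x :: "real \<Rightarrow> complex ^ 'd"
    and x0 :: "complex ^ 'd"
    and N :: nat
    and v :: "nat \<Rightarrow> int ^ 'd \<Rightarrow> real \<Rightarrow> complex"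
  assumes "D0 > 0" and "R > 0" and "\<mu>0 > 0"
    and "periodic_field_with_coeffs R g G"
    and "\<And>\<alpha> t. \<alpha> \<notin> mi_nonneg \<Longrightarrow> t \<ge> 0 \<Longrightarrow> g \<alpha> t = 0"
    and "\<And>k t. t \<ge> 0 \<Longrightarrow>
           (\<Sum>\<alpha> | mi_abs \<alpha> = k. \<Sum>j\<in>UNIV. cmod (g \<alpha> t $ j)) \<le> D0 / R ^ k"
    and "\<And>t. t \<ge> 0 \<Longrightarrow> (MIN j. Im (g 0 t $ j)) \<ge> \<mu>0"
    and "solves_ode_from G x0 x"
    and "norm (cexp (\<i> *s x0)) < \<mu>0 * R / (D0 + \<mu>0)"
    and "T > 0" and "N \<ge> 1"
    and "\<mu>0 * R * sup_norm (cexp (- (\<i> *s x0))) / D0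
           * ((D0 + \<mu>0) * norm (cexp (\<i> *s x0)) / (\<mu>0 * R)) ^ N
           * exp ((D0 + \<mu>0) * T) \<le> 1 / 2"
    and "finite_section_approx g x0 N v"
  shows "\<exists>\<xi> :: 'd \<Rightarrow> real \<Rightarrow> complex.
           (\<forall>j. continuous_on {0..T} (\<xi> j) \<and> \<xi> j 0 = x0 $ j \<and>
                (\<forall>t\<in>{0..T}. v 1 (axis j 1) t = exp (\<i> * \<xi> j t))) \<and>
           (\<forall>t\<in>{0..T}. (MAX j. cmod (\<xi> j t - x t $ j))
              \<le> 4 * \<mu>0 * R * sup_norm (cexp (- (\<i> *s x0))) / D0
                  * ((D0 + \<mu>0) * norm (cexp (\<i> *s x0)) / (\<mu>0 * R)) ^ N
                  * exp ((D0 + \<mu>0) * t))"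
proof -
  interpret carleman_fourier D0 R \<mu>0 G g x0 x
  proof
    fix t :: real and z :: "complex ^ 'd" assume "t \<ge> 0" and z: "\<And>j. cmod (exp (\<i> * z $ j)) < R"
    have "- ln R < Im (z $ j)" for j
      using z[of j] \<open>R > 0\<close> ln_less_cancel_iff[of "exp (- Im (z $ j))" R] by simp
    then have "(MIN j. Im (z $ j)) > - ln R" by (subst Min_gr_iff) auto
    then show "((\<lambda>\<gamma>. exp (\<i> * mi_dot \<gamma> z) *s g \<gamma> t) has_sum G t z) UNIV"
      using assms(4) \<open>t \<ge> 0\<close> by (simp add: periodic_field_with_coeffs_def)
  next
    show "\<mu>0 \<le> Im (g 0 t $ j)" if "t \<ge> 0" for t j
      using assms(7)[OF that] by (subst (asm) Min_ge_iff) auto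
  qed (use assms in auto)
  \<comment> \<open>\<open>z j\<close> is the relative error of the \<open>j\<close>-th entry; \<open>K\<close> is the prefactor in the hypothesis on \<open>N\<close>.\<close>
  define K where "K = \<mu>0 * R * sup_norm (cexp (- (\<i> *s x0))) / D0 * ((D0 + \<mu>0) * s / (\<mu>0 * R)) ^ N"
  define z where "z j t = v 1 (axis j 1) t / exp (\<i> * x t $ j) - 1" for j t
  define \<xi> where "\<xi> j t = x t $ j - \<i> * Ln (1 + z j t)" for j t
  have sup_pos: "0 < sup_norm (cexp (- (\<i> *s x0)))"
    unfolding sup_norm_def by (subst Max_gr_iff) (auto simp: cexp_def)
  \<comment> \<open>The bound on the relative error has \<open>s\<close> in place of \<open>\<mu>\<^sub>0R/D\<^sub>0\<close>.  The gap is strict, which turns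
    the hypothesis \<open>\<le> 1/2\<close> into the strict inequality needed for the logarithm.\<close>
  have "s < \<mu>0 * R / D0"
    using small assms(1-3) by (elim less_le_trans) (simp add: frac_le)
  then have "s * sup_norm (cexp (- (\<i> *s x0))) * ((D0 + \<mu>0) * s / (\<mu>0 * R)) ^ N
      < \<mu>0 * R / D0 * sup_norm (cexp (- (\<i> *s x0))) * ((D0 + \<mu>0) * s / (\<mu>0 * R)) ^ N"
    using sup_pos norm_cexp_pos[of x0] assms(1-3)
    by (intro mult_strict_right_mono zero_less_power divide_pos_pos mult_pos_pos) auto
  then have less_K: "s * sup_norm (cexp (- (\<i> *s x0))) * ((D0 + \<mu>0) * s / (\<mu>0 * R)) ^ N < K"
    by (simp add: K_def)
  have z_lt: "cmod (z j t) < K * exp ((D0 + \<mu>0) * t)" if "t \<ge> 0" for j t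
    unfolding z_def
    by (rule le_less_trans[OF relative_error[OF assms(13,11) that] mult_strict_right_mono[OF less_K]]) simp
  have K_T: "K * exp ((D0 + \<mu>0) * T) \<le> 1 / 2"
    using assms(12) unfolding K_def .
  have K_pos: "K \<ge> 0" using sup_pos assms(1-3) by (simp add: K_def)
  have z_half: "cmod (z j t) < 1 / 2" if "t \<in> {0..T}" for j t
  proof -
    have "K * exp ((D0 + \<mu>0) * t) \<le> K * exp ((D0 + \<mu>0) * T)"
      using that assms(1,3) K_pos by (intro mult_left_mono) auto
    then show ?thesis using z_lt[of t j] that K_T by (meson atLeastAtMost_iff less_le_trans order_trans)
  qed
  have not_nonpos: "1 + z j t \<notin> \<real>\<^sub>\<le>\<^sub>0" if "t \<in> {0..T}" for j t
  proof -
    have "- Re (z j t) < 1 / 2" using z_half[OF that, of j] abs_Re_le_cmod[of "z j t"] by linarith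
    then show ?thesis by (auto simp: complex_nonpos_Reals_iff)
  qed
  have ax: "axis j 1 \<in> mi_level 1" for j :: 'd
    by (rule axis_in_mi_level)
  have v: "(v 1 (axis j 1) has_vector_derivative (\<Sum>l=1..N. \<Sum>\<beta>\<in>mi_level l.
      cf_entry g t (axis j 1) \<beta> * v l \<beta> t)) (at t within {0..})" if "t \<ge> 0" for j t
    using assms(11,13) ax that by (simp add: finite_section_approx_def)
  have cont_v: "continuous_on {0..T} (v 1 (axis j 1))" for j
    by (rule continuous_on_subset[of "{0..}"])
      (use v in \<open>auto simp: continuous_on_eq_continuous_within intro: has_vector_derivative_continuous\<close>)
  have cont_x: "continuous_on {0..T} x"
    by (rule continuous_on_subset[of "{0..}"])
      (use assms(8) in \<open>auto simp: solves_ode_from_def continuous_on_eq_continuous_within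
        intro: has_vector_derivative_continuous\<close>)
  show ?thesis
  proof (intro exI[of _ \<xi>] conjI allI ballI)
    fix j
    show "continuous_on {0..T} (\<xi> j)"
      unfolding \<xi>_def[abs_def] using not_nonpos cont_v cont_x
      by (intro continuous_intros) (auto simp: z_def[abs_def] intro!: continuous_intros)
    have "v 1 (axis j 1) 0 = exp (\<i> * x0 $ j)"
      using assms(11,13) ax by (simp add: finite_section_approx_def mi_dot_axis)
    then show "\<xi> j 0 = x0 $ j" by (simp add: \<xi>_def z_def start)
    fix t assume t: "t \<in> {0..T}"
    have "1 + z j t \<noteq> 0" using not_nonpos[OF t, of j] by auto
    then have "exp (\<i> * \<xi> j t) = exp (\<i> * x t $ j) * (1 + z j t)"
      by (simp add: \<xi>_def algebra_simps exp_add)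
    then show "v 1 (axis j 1) t = exp (\<i> * \<xi> j t)" by (simp add: z_def)
  next
    fix t assume t: "t \<in> {0..T}"
    have "cmod (\<xi> j t - x t $ j) \<le> 4 * (K * exp ((D0 + \<mu>0) * t))" for j
    proof -
      have "cmod (z j t) < K * exp ((D0 + \<mu>0) * t)" using z_lt t by simp
      then have "cmod (Ln (1 + z j t)) \<le> 4 * (K * exp ((D0 + \<mu>0) * t))"
        using norm_Ln_le[OF z_half[OF t, of j]] norm_ge_zero[of "z j t"] by linarith
      then show ?thesis by (simp add: \<xi>_def norm_mult)
    qed
    then show "(MAX j. cmod (\<xi> j t - x t $ j))
        \<le> 4 * \<mu>0 * R * sup_norm (cexp (- (\<i> *s x0))) / D0
          * ((D0 + \<mu>0) * norm (cexp (\<i> *s x0)) / (\<mu>0 * R)) ^ N * exp ((D0 + \<mu>0) * t)"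
      by (subst Max_le_iff) (auto simp: K_def mult.assoc)
  qed
qed

end
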